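(* Let $m\ge 0$ be an integer. Then for every integer $n\ge 1$, $$\int_{-\infty}^{\infty}2\sum_{k=0}^{m}\cos\bigl((2k+1)\pi t\bigr)\,\operatorname{sinc}^{n}(\pi t)\,dt\ \begin{cases}=1, & \text{if } n=1,2,\ldots,2m+3,\\ <1, & \text{if } n=2m+4,\,2m+5,\ldots\end{cases}$$
   Context: Here $\operatorname{sinc}(t)=\frac{\sin t}{t}$ for $t\neq 0$ and $\operatorname{sinc}(0)=1$; $\operatorname{sinc}^{n}(x)$ denotes $(\operatorname{sinc}(x))^{n}$. The integrals are improper integrals, $\int_{-\infty}^{\infty}=\lim_{R\to\infty}\int_{-R}^{R}$ (for $n=1$ the integral is only conditionally convergent). *)

theory Defs
  imports "HOL-Probability.Sinc_Integral"
begin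

text \<open>
  \<^term>\<open>sinc\<close> is the library's unnormalised version, with \<^prop>\<open>sinc 0 = 1\<close>.
  Improper integrals over the real line are limits over symmetric intervals.
\<close>

definition has_improper_integral :: "(real \<Rightarrow> real) \<Rightarrow> real \<Rightarrow> bool"
    (infixr \<open>has'_improper'_integral\<close> 46)
  where "(f has_improper_integral I) \<longleftrightarrow>
    (\<forall>R>0. f integrable_on {-R..R}) \<and>
    ((\<lambda>R. integral {-R..R} f) \<longlongrightarrow> I) at_top"

end

theory Submission
  imports Defs "HOL-Probability.Convolution" "HOL-Probability.Levy"
begin

text \<open>
  Write \<open>N = 2 * m + 2\<close>. Multiplying the cosine sum by \<open>sin (pi * t)\<close> makes it telescope to
  \<open>sin (N * pi * t)\<close>, so one factor \<open>sinc (pi * t)\<close> turns the integrand into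
  \<open>sin (N * pi * t) / (pi * t) * sinc (pi * t) ^ (n - 1)\<close>, as in the Borwein integrals
  (lemma \<open>integrand_eq\<close>).

  Here \<open>sinc (pi * t) ^ (n - 1)\<close> is the characteristic function of a sum \<open>S\<close> of \<open>n - 1\<close>
  independent variables, each uniform on \<open>[-pi, pi]\<close> (\<open>char_unif_sum\<close>), and
  \<open>2 * sin (N * pi * t) / t\<close> is the kernel of Levy's inversion formula for the interval
  \<open>(-N * pi, N * pi]\<close>. The improper integral is therefore the probability that \<open>S\<close> lies in this
  interval. Since the support of \<open>S\<close> is exactly \<open>[-(n - 1) * pi, (n - 1) * pi]\<close>, this
  probability is 1 when \<open>n - 1 \<le> N\<close> (\<open>prob_unif_sum_eq_1\<close>) and less than 1 when
  \<open>n - 1 > N\<close> (\<open>prob_unif_sum_less_1\<close>); and \<open>n - 1 \<le> N\<close> means \<open>n \<le> 2 * m + 3\<close>.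

  Levy's formula gives the limit over integer cutoffs only; the bound \<open>1 / \<bar>t\<bar>\<close> for the
  integrand extends it to real cutoffs (\<open>tendsto_symmetric_integral_from_nat\<close>).
\<close>

section \<open>Sums of independent uniform variables\<close>

lemma real_distribution_convolution:
  assumes "real_distribution M" "real_distribution N"
  shows "real_distribution (M \<star> N)"
proof -
  interpret M: real_distribution M by fact
  interpret N: real_distribution N by fact
  interpret P: pair_prob_space M N ..
  have [measurable_cong]: "sets M = sets borel" "sets N = sets borel" by simp_all
  show ?thesis
    unfolding convolution_def by (intro P.real_distribution_distr) measurable
qed

text \<open>
  The convolution is the law of the sum of independent variables, so Fubini's theorem splits the
  exponential \<open>iexp (t * (x + y))\<close> into a product of two integrals.
\<close>

lemma char_convolution:
  assumes "real_distribution M" "real_distribution N"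
  shows "char (M \<star> N) t = char M t * char N t"
proof -
  interpret M: real_distribution M by fact
  interpret N: real_distribution N by fact
  interpret P: pair_prob_space M N ..
  have [measurable_cong]: "sets M = sets borel" "sets N = sets borel" by simp_all
  have int: "integrable (M \<Otimes>\<^sub>M N) (\<lambda>(x, y). iexp (t * (x + y)))"
    by (intro P.integrable_const_bound[of _ 1]) (auto simp: case_prod_beta)
  have "char (M \<star> N) t = (CLINT z|M \<Otimes>\<^sub>M N. (case z of (x, y) \<Rightarrow> iexp (t * (x + y))))"
    unfolding char_def convolution_def by (subst integral_distr) (auto simp: case_prod_unfold)
  also have "\<dots> = (CLINT x|M. (CLINT y|N. iexp (t * (x + y))))"
    using P.integral_fst'[OF int] by simp
  also have "\<dots> = (CLINT x|M. iexp (t * x) * char N t)"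
    unfolding char_def by (simp add: distrib_left exp_add)
  also have "\<dots> = char M t * char N t"
    unfolding char_def by simp
  finally show ?thesis .
qed

text \<open>
  The half-width \<open>pi\<close> makes the characteristic function \<open>sinc (pi * t)\<close>, so that Levy's integral
  appears in the variable of the theorem and needs no substitution.
\<close>

abbreviation unif :: "real measure"
  where "unif \<equiv> uniform_measure lborel {-pi..pi}"

primrec unif_sum :: "nat \<Rightarrow> real measure"
  where
    "unif_sum 0 = return borel 0"
  | "unif_sum (Suc k) = (unif_sum k \<star> unif)"

lemma real_distribution_unif: "real_distribution unif"
  by (auto simp: real_distribution_def real_distribution_axioms_def intro!: prob_space_uniform_measure)

lemma real_distribution_unif_sum: "real_distribution (unif_sum k)"
proof (induction k)
  case 0
  show ?case
    by (auto simp: real_distribution_def real_distribution_axioms_def intro!: prob_space_return)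
next
  case (Suc k)
  then show ?case
    by (simp add: real_distribution_convolution real_distribution_unif)
qed

lemma char_unif: "char unif t = complex_of_real (sinc (pi * t))"
proof -
  have "char unif t = (CLINT x|density lborel (\<lambda>x. ennreal (indicator {-pi..pi} x / (2 * pi))). iexp (t * x))"
    unfolding char_def uniform_measure_def
    by (intro arg_cong2[where f = "integral\<^sup>L"] arg_cong2[where f = density] ext)
       (auto simp: indicator_def divide_ennreal[symmetric])
  also have "\<dots> = (CLINT x|lborel. (indicator {-pi..pi} x / (2 * pi)) *\<^sub>R iexp (t * x))"
    by (intro integral_density) auto
  also have "\<dots> = (CLINT x|lborel. (1 / (2 * pi)) *\<^sub>R (indicator {-pi..pi} x *\<^sub>R iexp (t * x)))"
    by (intro Bochner_Integration.integral_cong) auto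
  also have "\<dots> = (1 / (2 * pi)) *\<^sub>R (CLINT x|lborel. indicator {-pi..pi} x *\<^sub>R iexp (t * x))"
    by (rule integral_scaleR_right)
  also have "(CLINT x|lborel. indicator {-pi..pi} x *\<^sub>R iexp (t * x)) = 2 * pi * sinc (pi * t)"
  proof (cases "t = 0")
    case True
    then show ?thesis
      by (simp add: scaleR_conv_of_real)
  next
    case False
    have "(CLINT x|lborel. indicator {-pi..pi} x *\<^sub>R iexp (t * x))
        = iexp (t * pi) / (\<i> * t) - iexp (t * (-pi)) / (\<i> * t)"
      by (rule integral_FTC_Icc[where F = "\<lambda>x. iexp (t * x) / (\<i> * t)", of "-pi" pi])
         (use False in \<open>auto intro!: derivative_eq_intros continuous_intros
            simp: has_vector_derivative_complex_iff Re_exp Im_exp Re_divide Im_divide field_simps power2_eq_square\<close>)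
    also have "\<dots> = 2 * pi * sinc (pi * t)"
      using False by (simp add: complex_eq_iff Re_exp Im_exp Re_divide Im_divide field_simps power2_eq_square)
    finally show ?thesis .
  qed
  finally show ?thesis
    by (simp add: scaleR_conv_of_real)
qed

lemma char_unif_sum: "char (unif_sum k) t = complex_of_real (sinc (pi * t) ^ k)"
proof (induction k)
  case 0
  show ?case by (simp add: char_def integral_return)
next
  case (Suc k)
  then show ?case
    by (simp add: char_convolution real_distribution_unif real_distribution_unif_sum char_unif mult.commute)
qed

text \<open>
  Conditioning on the sum of the first \<open>k\<close> summands. The three facts about the distribution of the
  sum that follow (no atoms, support, mass near the end of the support) all come from this formula.
\<close>

lemma emeasure_unif_sum_Suc:
  assumes "A \<in> sets borel"
  shows "emeasure (unif_sum (Suc k)) A = (\<integral>\<^sup>+x. emeasure unif {a. a + x \<in> A} \<partial>unif_sum k)"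
proof -
  interpret M: real_distribution "unif_sum k" by (rule real_distribution_unif_sum)
  interpret N: real_distribution unif by (rule real_distribution_unif)
  show ?thesis
    using assms M.finite_measure_axioms N.finite_measure_axioms
    by (simp add: convolution_emeasure)
qed

text \<open>
  The empty sum has its atom at 0; as soon as there is a summand, its density excludes atoms.
\<close>

lemma unif_sum_no_atom:
  assumes "a \<noteq> 0"
  shows "emeasure (unif_sum k) {a} = 0"
proof (cases k)
  case 0
  then show ?thesis using assms by simp
next
  case (Suc j)
  have "{b. b + x = a} = {a - x}" for x
    by auto
  then have "emeasure unif {b. b + x = a} = 0" for x
    by (simp add: emeasure_lborel_countable)
  then show ?thesis
    unfolding Suc by (subst emeasure_unif_sum_Suc) auto
qed

lemma unif_sum_support: "AE x in unif_sum k. \<bar>x\<bar> \<le> real k * pi"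
proof (induction k)
  case 0
  show ?case unfolding unif_sum.simps by (subst AE_return) auto
next
  case (Suc k)
  interpret M: real_distribution "unif_sum (Suc k)" by (rule real_distribution_unif_sum)
  let ?A = "{x::real. real (Suc k) * pi < \<bar>x\<bar>}"
  have A: "?A \<in> sets borel" by measurable
  have "AE x in unif_sum k. emeasure unif {a. a + x \<in> ?A} = 0"
    using Suc
  proof eventually_elim
    case (elim x)
    have [measurable]: "{a. a + x \<in> ?A} \<in> sets borel" by measurable
    have "{-pi..pi} \<inter> {a. a + x \<in> ?A} = {}"
      using elim by (auto simp: abs_if algebra_simps split: if_splits)
    then show ?case by simp
  qed
  then have "(\<integral>\<^sup>+x. emeasure unif {a. a + x \<in> ?A} \<partial>unif_sum k) = (\<integral>\<^sup>+x. 0 \<partial>unif_sum k)"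
    by (rule nn_integral_cong_AE)
  then have "emeasure (unif_sum (Suc k)) ?A = 0"
    using emeasure_unif_sum_Suc[OF A] by simp
  then show ?case
    by (intro AE_I[where N = ?A]) (use A in \<open>auto simp: not_le\<close>)
qed

text \<open>
  The end of the support is approached with positive probability: it suffices that the first \<open>k\<close>
  summands come within \<open>\<epsilon> / 2\<close> of their maximal sum and that the last one, independently, comes
  within \<open>\<epsilon> / 2\<close> of \<open>pi\<close>.
\<close>

lemma unif_sum_near_top:
  assumes "\<epsilon> > 0"
  shows "emeasure (unif_sum k) {x. real k * pi - \<epsilon> < x} > 0"
  using assms
proof (induction k arbitrary: \<epsilon>)
  case 0
  then show ?case by simp
next
  case (Suc k)
  interpret M: real_distribution "unif_sum k" by (rule real_distribution_unif_sum)
  let ?A = "{x. real (Suc k) * pi - \<epsilon> < x}"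
  let ?B = "{x. real k * pi - \<epsilon> / 2 < x}" and ?C = "{x. pi - \<epsilon> / 2 < x}"
  have A: "?A \<in> sets borel" and B: "?B \<in> sets borel" and C: "?C \<in> sets borel" by measurable
  have "emeasure lborel ({max (-pi) (pi - \<epsilon> / 2)<..<pi}) \<le> emeasure lborel ({-pi..pi} \<inter> ?C)"
    by (intro emeasure_mono) auto
  moreover have "emeasure lborel ({max (-pi) (pi - \<epsilon> / 2)<..<pi}) > 0"
    using Suc.prems pi_gt_zero by (subst emeasure_lborel_Ioo) auto
  ultimately have "emeasure lborel ({-pi..pi} \<inter> ?C) > 0" by simp
  then have posC: "emeasure unif ?C > 0"
    using C by (simp add: ennreal_zero_less_divide)
  have "0 < emeasure unif ?C * emeasure (unif_sum k) ?B"
    using posC Suc.IH[of "\<epsilon> / 2"] Suc.prems by (simp add: ennreal_zero_less_mult_iff)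
  also have "\<dots> = (\<integral>\<^sup>+x. emeasure unif ?C * indicator ?B x \<partial>unif_sum k)"
    using B by (simp add: nn_integral_cmult_indicator)
  also have "\<dots> \<le> (\<integral>\<^sup>+x. emeasure unif {a. a + x \<in> ?A} \<partial>unif_sum k)"
  proof (intro nn_integral_mono)
    fix x :: real
    have [measurable]: "{a. a + x \<in> ?A} \<in> sets borel" by measurable
    have "x \<in> ?B \<Longrightarrow> ?C \<subseteq> {a. a + x \<in> ?A}"
      by (auto simp: algebra_simps)
    then have "x \<in> ?B \<Longrightarrow> emeasure unif ?C \<le> emeasure unif {a. a + x \<in> ?A}"
      by (intro emeasure_mono) auto
    then show "emeasure unif ?C * indicator ?B x \<le> emeasure unif {a. a + x \<in> ?A}"
      by (auto simp: indicator_def)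
  qed
  also have "\<dots> = emeasure (unif_sum (Suc k)) ?A"
    using emeasure_unif_sum_Suc[OF A] by simp
  finally show ?case .
qed

text \<open>
  In the boundary case \<open>k = N\<close> the half-open interval misses the left end of the support, which
  is not an atom.
\<close>

lemma prob_unif_sum_eq_1:
  assumes "0 < N" "k \<le> N"
  shows "measure (unif_sum k) {-(real N * pi)<..real N * pi} = 1"
proof -
  interpret M: real_distribution "unif_sum k" by (rule real_distribution_unif_sum)
  have "AE x in unif_sum k. x \<notin> {-(real N * pi)}"
    using assms by (intro AE_not_in) (auto intro!: unif_sum_no_atom)
  with unif_sum_support[of k] have "AE x in unif_sum k. x \<in> {-(real N * pi)<..real N * pi}"
  proof eventually_elim
    case (elim x)
    have "real k * pi \<le> real N * pi" using assms by simp
    with elim show ?case unfolding greaterThanAtMost_iff singleton_iff by arith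
  qed
  then show ?thesis by (intro M.prob_eq_1[THEN iffD2]) auto
qed

lemma prob_unif_sum_less_1:
  assumes "N < k"
  shows "measure (unif_sum k) {-(real N * pi)<..real N * pi} < 1"
proof -
  interpret M: real_distribution "unif_sum k" by (rule real_distribution_unif_sum)
  let ?I = "{-(real N * pi)<..real N * pi}" and ?J = "{x. real N * pi < x}"
  have "0 < emeasure (unif_sum k) ?J"
    using unif_sum_near_top[of "real k * pi - real N * pi" k] assms by simp
  then have "0 < measure (unif_sum k) ?J"
    by (simp add: M.emeasure_eq_measure)
  moreover have "measure (unif_sum k) (?I \<union> ?J) = measure (unif_sum k) ?I + measure (unif_sum k) ?J"
    by (intro M.finite_measure_Union) auto
  moreover have "measure (unif_sum k) (?I \<union> ?J) \<le> 1"
    by simp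
  ultimately show ?thesis by linarith
qed

section \<open>The integrand and its symmetric integrals\<close>

lemma sin_times_sum_cos_odd:
  fixes x :: real
  shows "sin x * (2 * (\<Sum>k=0..m. cos ((2 * real k + 1) * x))) = sin ((2 * real m + 2) * x)"
proof (induction m)
  case 0
  show ?case by (simp add: sin_double)
next
  case (Suc m)
  have "sin ((2 * real m + 3) * x + x) - sin ((2 * real m + 3) * x - x)
      = 2 * sin x * cos ((2 * real m + 3) * x)"
    by (simp only: sin_add sin_diff) simp
  then have "sin ((2 * real (Suc m) + 2) * x)
      = sin ((2 * real m + 2) * x) + 2 * sin x * cos ((2 * real m + 3) * x)"
    by (simp add: algebra_simps)
  then show ?case
    using Suc by (simp add: distrib_left add.commute)
qed

lemma integrand_eq:
  assumes "t \<noteq> 0" "n \<ge> 1"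
  shows "2 * (\<Sum>k=0..m. cos ((2 * real k + 1) * pi * t)) * sinc (pi * t) ^ n
    = sin (real (2 * m + 2) * pi * t) / (pi * t) * sinc (pi * t) ^ (n - 1)"
proof -
  have "sinc (pi * t) ^ n = sin (pi * t) / (pi * t) * sinc (pi * t) ^ (n - 1)"
    using assms by (cases n) auto
  then have "2 * (\<Sum>k=0..m. cos ((2 * real k + 1) * pi * t)) * sinc (pi * t) ^ n
    = sin (pi * t) * (2 * (\<Sum>k=0..m. cos ((2 * real k + 1) * (pi * t)))) / (pi * t) * sinc (pi * t) ^ (n - 1)"
    by (simp only: mult.assoc mult.commute times_divide_eq_left times_divide_eq_right mult.left_commute)
  moreover have "real (2 * m + 2) = 2 * real m + 2"
    by simp
  ultimately show ?thesis
    unfolding sin_times_sum_cos_odd by (simp only: mult.assoc)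
qed

text \<open>
  The integrals over \<open>[-R, R]\<close> and over \<open>[-k, k]\<close> with \<open>k = \<lfloor>R\<rfloor>\<close> differ by two
  integrals over intervals of length at most 1 on which the integrand is at most \<open>1 / k\<close>.
\<close>

lemma tendsto_symmetric_integral_from_nat:
  fixes f :: "real \<Rightarrow> real"
  assumes cont: "continuous_on UNIV f"
    and bound: "\<And>t. \<bar>t\<bar> > 0 \<Longrightarrow> \<bar>f t\<bar> \<le> 1 / \<bar>t\<bar>"
    and lim: "(\<lambda>T::nat. integral {-real T..real T} f) \<longlonglongrightarrow> I"
  shows "((\<lambda>R. integral {-R..R} f) \<longlongrightarrow> I) at_top"
proof -
  define T where "T R = nat \<lfloor>R\<rfloor>" for R :: real
  have int: "f integrable_on {a..b}" for a b
    using cont by (intro integrable_continuous_interval) (rule continuous_on_subset, auto)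
  have T: "filterlim T at_top at_top"
    unfolding T_def
    by (intro filterlim_compose[OF filterlim_nat_sequentially filterlim_floor_sequentially])
  have "((\<lambda>R. integral {-real (T R)..real (T R)} f) \<longlongrightarrow> I) at_top"
    by (rule filterlim_compose[OF lim T])
  moreover have "((\<lambda>R. integral {-R..R} f - integral {-real (T R)..real (T R)} f) \<longlongrightarrow> 0) at_top"
  proof (rule Lim_null_comparison)
    show "((\<lambda>R. 2 / real (T R)) \<longlongrightarrow> 0) at_top"
      by (intro tendsto_divide_0[OF tendsto_const] filterlim_at_top_imp_at_infinity
            filterlim_compose[OF filterlim_real_sequentially T])
    show "\<forall>\<^sub>F R in at_top. norm (integral {-R..R} f - integral {-real (T R)..real (T R)} f) \<le> 2 / real (T R)"
      using eventually_ge_at_top[of 1]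
    proof eventually_elim
      case (elim R)
      define k where "k = real (T R)"
      have k: "1 \<le> k" "k \<le> R" "R \<le> k + 1"
        using elim by (auto simp: k_def T_def)
      have tail: "\<bar>integral {a..b} f\<bar> \<le> 1 / k"
        if "a \<le> b" "b - a \<le> 1" "\<And>x. x \<in> {a..b} \<Longrightarrow> k \<le> \<bar>x\<bar>" for a b
      proof -
        have "norm (integral {a..b} f) \<le> 1 / k * (b - a)"
        proof (rule integral_bound)
          show "\<And>t. t \<in> {a..b} \<Longrightarrow> norm (f t) \<le> 1 / k"
            using that(3) k bound
            by (smt (verit) frac_le real_norm_def)
        qed (use that cont in \<open>auto intro: continuous_on_subset\<close>)
        also have "\<dots> \<le> 1 / k * 1"
          using k that by (intro mult_left_mono) auto
        finally show ?thesis by simp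
      qed
      have "integral {-R..-k} f + integral {-k..R} f = integral {-R..R} f"
        using k int by (intro Henstock_Kurzweil_Integration.integral_combine) auto
      moreover have "integral {-k..k} f + integral {k..R} f = integral {-k..R} f"
        using k int by (intro Henstock_Kurzweil_Integration.integral_combine) auto
      moreover have "\<bar>integral {-R..-k} f\<bar> \<le> 1 / k" "\<bar>integral {k..R} f\<bar> \<le> 1 / k"
        using k by (auto intro!: tail)
      ultimately show ?case
        unfolding k_def[symmetric] by simp
    qed
  qed
  ultimately have "((\<lambda>R. integral {-real (T R)..real (T R)} f
      + (integral {-R..R} f - integral {-real (T R)..real (T R)} f)) \<longlongrightarrow> I + 0) at_top"
    by (rule tendsto_add)
  then show ?thesis by simp
qed

lemma abs_sinc_le_1: "\<bar>sinc x\<bar> \<le> 1"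
  by (cases "x = 0") (auto simp: divide_le_eq_1 abs_sin_x_le_abs_x)

section \<open>The integral as a probability\<close>

theorem mainTheorem3:
  fixes m n :: nat
  assumes "n \<ge> 1"
  shows "\<exists>I. ((\<lambda>t. 2 * (\<Sum>k=0..m. cos ((2 * real k + 1) * pi * t)) * sinc (pi * t) ^ n)
            has_improper_integral I) \<and>
          (n \<le> 2 * m + 3 \<longrightarrow> I = 1) \<and>
          (n \<ge> 2 * m + 4 \<longrightarrow> I < 1)"
proof -
  define N where "N = 2 * m + 2"
  define k where "k = n - 1"
  define b where "b = real N * pi"
  define f where "f = (\<lambda>t. 2 * (\<Sum>k=0..m. cos ((2 * real k + 1) * pi * t)) * sinc (pi * t) ^ n)"
  define I where "I = measure (unif_sum k) {-b<..b}"
  interpret M: real_distribution "unif_sum k" by (rule real_distribution_unif_sum)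
  have b: "b > 0" by (simp add: b_def N_def)
  have f_eq: "f t = sin (b * t) / (pi * t) * sinc (pi * t) ^ k" if "t \<noteq> 0" for t
    using integrand_eq[OF that assms, of m] by (simp add: f_def b_def N_def k_def)
  have cont: "continuous_on A f" for A
    unfolding f_def by (intro continuous_intros)
  have bound: "\<bar>f t\<bar> \<le> 1 / \<bar>t\<bar>" if "\<bar>t\<bar> > 0" for t
  proof -
    have sinc_power: "\<bar>sinc (pi * t) ^ k\<bar> \<le> 1"
      unfolding power_abs by (intro power_le_one abs_ge_zero abs_sinc_le_1)
    have "\<bar>f t\<bar> = \<bar>sin (b * t)\<bar> * \<bar>sinc (pi * t) ^ k\<bar> / (pi * \<bar>t\<bar>)"
      using f_eq that by (simp add: abs_mult)
    also have "\<dots> \<le> 1 * 1 / (1 * \<bar>t\<bar>)"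
      using that pi_gt3
      by (intro frac_le mult_mono mult_right_mono abs_sin_le_one sinc_power) auto
    finally show ?thesis by simp
  qed
  have no_atom: "measure (unif_sum k) {-b} = 0" "measure (unif_sum k) {b} = 0"
    using b unif_sum_no_atom by (simp_all add: measure_def)
  \<comment> \<open>For the interval \<open>(-b, b]\<close> Levy's kernel is \<open>2 * sin (b * t) / t\<close>; the point 0, where it
      divides by zero, is negligible.\<close>
  have levy_integral: "1 / (2 * pi) * (CLBINT t=-real T..real T.
      (iexp (-(t * (-b))) - iexp (-(t * b))) / (\<i> * t) * char (unif_sum k) t)
    = complex_of_real (integral {-real T..real T} f)" for T :: nat
  proof -
    have "(CLBINT t=-real T..real T.
        (iexp (-(t * (-b))) - iexp (-(t * b))) / (\<i> * t) * char (unif_sum k) t)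
      = (CLBINT t=-real T..real T. complex_of_real (2 * pi * f t))"
    proof (rule interval_integral_cong_AE)
      show "AE t \<in> einterval (min (ereal (-real T)) (ereal (real T))) (max (ereal (-real T)) (ereal (real T))) in lborel.
        (iexp (-(t * (-b))) - iexp (-(t * b))) / (\<i> * t) * char (unif_sum k) t
          = complex_of_real (2 * pi * f t)"
        using AE_lborel_singleton[of "0::real"]
      proof eventually_elim
        case (elim t)
        have "(iexp (-(t * (-b))) - iexp (-(t * b))) / (\<i> * t) = complex_of_real (2 * sin (b * t) / t)"
          using elim by (simp add: complex_eq_iff Re_exp Im_exp Re_divide Im_divide field_simps power2_eq_square)
        then show ?case
          using elim f_eq[of t] by (simp add: char_unif_sum)
      qed
      show "(\<lambda>t. complex_of_real (2 * pi * f t)) \<in> borel_measurable borel"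
        by (intro borel_measurable_continuous_onI continuous_intros cont)
    qed measurable
    also have "\<dots> = complex_of_real (LBINT t=-real T..real T. 2 * pi * f t)"
      by (rule interval_lebesgue_integral_of_real)
    also have "(LBINT t=-real T..real T. 2 * pi * f t) = integral {-real T..real T} (\<lambda>t. 2 * pi * f t)"
      by (intro interval_integral_eq_integral borel_integrable_atLeastAtMost') (auto intro!: continuous_intros cont)
    finally show ?thesis by simp
  qed
  have "(\<lambda>T::nat. complex_of_real (integral {-real T..real T} f)) \<longlonglongrightarrow> complex_of_real I"
    using M.Levy_Inversion[of "-b" b] b no_atom levy_integral by (simp add: I_def)
  then have "(\<lambda>T::nat. integral {-real T..real T} f) \<longlonglongrightarrow> I"
    by (simp add: tendsto_of_real_iff)
  with cont bound have "((\<lambda>R. integral {-R..R} f) \<longlongrightarrow> I) at_top"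
    by (rule tendsto_symmetric_integral_from_nat)
  then have "f has_improper_integral I"
    unfolding has_improper_integral_def using cont by (auto intro: integrable_continuous_interval)
  moreover have "n \<le> 2 * m + 3 \<longrightarrow> I = 1"
    using prob_unif_sum_eq_1[of N k] by (auto simp: I_def b_def N_def k_def)
  moreover have "n \<ge> 2 * m + 4 \<longrightarrow> I < 1"
    using prob_unif_sum_less_1[of N k] by (auto simp: I_def b_def N_def k_def)
  ultimately show ?thesis
    unfolding f_def by blast
qed

end
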